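(* The class of paracontact metric structures whose Reeb vector field is an infinitesimal harmonic transformation is strictly larger than the class of $K$-paracontact structures: the Reeb vector field of every $K$-paracontact metric manifold is an infinitesimal harmonic transformation, and there exist paracontact metric manifolds $(M,\varphi,\xi,\eta,g)$ which are not $K$-paracontact and whose Reeb vector field $\xi$ is an infinitesimal harmonic transformation.
   Context: All manifolds are smooth and connected. A $(2n+1)$-dimensional contact manifold is a manifold $M^{2n+1}$ with a global 1-form $\eta$ such that $\eta\wedge(d\eta)^n\neq 0$ everywhere; its Reeb vector field $\xi$ is the unique vector field with $\eta(\xi)=1$, $d\eta(\xi,\cdot)=0$. A paracontact metric structure $(\varphi,\xi,\eta,g)$ on $M$ consists of such $\eta,\xi$, a semi-Riemannian metric $g$ and a $(1,1)$-tensor $\varphi$ with $\eta=g(\xi,\cdot)$, $d\eta(\cdot,\cdot)=g(\cdot,\varphi\,\cdot)$, $\varphi^2=I-\eta\otimes\xi$ (here $2\,d\eta(X,Y)=X\eta(Y)-Y\eta(X)-\eta([X,Y])$). It is $K$-paracontact if $\xi$ is a Killing vector field (equivalently, $h=\frac12\mathcal L_\xi\varphi=0$). A vector field $V$ on a semi-Riemannian manifold is an infinitesimal harmonic transformation (also called $1$-harmonic) if $\mathrm{tr}(L_V\nabla)=0$, where $L_V\nabla$ is the Lie derivative of the Levi-Civita connection $\nabla$ and the trace is with respect to $g$; equivalently, $\bar\Delta V=QV$, where $Q$ is the Ricci operator and $\bar\Delta V=-\mathrm{tr}\,\nabla^2V=\sum_i\varepsilon_i(\nabla_{\nabla_{E_i}E_i}V-\nabla_{E_i}\nabla_{E_i}V)$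 for a local pseudo-orthonormal frame $\{E_i\}$, $\varepsilon_i=g(E_i,E_i)=\pm1$. *)

theory Defs
  imports "HOL-Analysis.Analysis" "HOL-Combinatorics.Permutations"
begin

section \<open>Smooth manifolds\<close>

fun Ck_on :: "nat \<Rightarrow> 'e::real_normed_vector set \<Rightarrow> ('e \<Rightarrow> 'f::real_normed_vector) \<Rightarrow> bool" where
  "Ck_on 0 S f \<longleftrightarrow> continuous_on S f"
| "Ck_on (Suc k) S f \<longleftrightarrow>
     (\<forall>x\<in>S. f differentiable (at x)) \<and>
     (\<forall>v. Ck_on k S (\<lambda>x. frechet_derivative f (at x) v))"

text \<open>Meant for open sets \<open>S\<close> of a Euclidean space.\<close>
definition smooth_on :: "'e::real_normed_vector set \<Rightarrow> ('e \<Rightarrow> 'f::real_normed_vector) \<Rightarrow> bool" where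
  "smooth_on S f \<longleftrightarrow> (\<forall>k. Ck_on k S f)"

text \<open>The underlying set of a manifold is a whole type \<open>'a\<close>; the sort constraint makes it Hausdorff
  and second countable. The type \<open>'e\<close> is the Euclidean space in which the charts take their values,
  so the dimension is \<open>DIM('e)\<close>. The smooth structure is given by an atlas, which need not be
  maximal.\<close>
type_synonym ('a, 'e) atlas = "('a set \<times> ('a \<Rightarrow> 'e)) set"

definition smooth_manifold ::
  "('a::{t2_space,second_countable_topology}, 'e::euclidean_space) atlas \<Rightarrow> bool" where
  "smooth_manifold A \<longleftrightarrow>
     connected (UNIV :: 'a set) \<and>
     (\<Union>(U, \<psi>)\<in>A. U) = UNIV \<and>
     (\<forall>(U, \<psi>)\<in>A. open U \<and> open (\<psi> ` U) \<and> homeomorphism U (\<psi> ` U) \<psi> (inv_into U \<psi>)) \<and>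
     (\<forall>(U, \<psi>)\<in>A. \<forall>(V, \<psi>')\<in>A. smooth_on (\<psi> ` (U \<inter> V)) (\<psi>' \<circ> inv_into U \<psi>))"

definition smooth_functions :: "('a, 'e::euclidean_space) atlas \<Rightarrow> ('a \<Rightarrow> real) set" where
  "smooth_functions A = {f. \<forall>(U, \<psi>)\<in>A. smooth_on (\<psi> ` U) (f \<circ> inv_into U \<psi>)}"

section \<open>Vector fields\<close>

text \<open>A vector field acts on smooth functions as a derivation; \<open>X f p\<close> is the value on \<open>f\<close> of the
  tangent vector of \<open>X\<close> at \<open>p\<close>. Outside the smooth functions \<open>X\<close> is set to zero, so that equality
  of vector fields is equality in HOL.\<close>
type_synonym 'a vfield = "('a \<Rightarrow> real) \<Rightarrow> 'a \<Rightarrow> real"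

definition vector_fields :: "('a, 'e::euclidean_space) atlas \<Rightarrow> 'a vfield set" where
  "vector_fields A = {X.
     (\<forall>f\<in>smooth_functions A. X f \<in> smooth_functions A) \<and>
     (\<forall>f. f \<notin> smooth_functions A \<longrightarrow> X f = (\<lambda>p. 0)) \<and>
     (\<forall>f\<in>smooth_functions A. \<forall>h\<in>smooth_functions A.
        X (\<lambda>p. f p + h p) = (\<lambda>p. X f p + X h p)) \<and>
     (\<forall>c. \<forall>f\<in>smooth_functions A. X (\<lambda>p. c * f p) = (\<lambda>p. c * X f p)) \<and>
     (\<forall>f\<in>smooth_functions A. \<forall>h\<in>smooth_functions A.
        X (\<lambda>p. f p * h p) = (\<lambda>p. X f p * h p + f p * X h p))}"

definition vf_add :: "'a vfield \<Rightarrow> 'a vfield \<Rightarrow> 'a vfield" where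
  "vf_add X Y = (\<lambda>f p. X f p + Y f p)"

definition vf_diff :: "'a vfield \<Rightarrow> 'a vfield \<Rightarrow> 'a vfield" where
  "vf_diff X Y = (\<lambda>f p. X f p - Y f p)"

definition vf_scale :: "('a \<Rightarrow> real) \<Rightarrow> 'a vfield \<Rightarrow> 'a vfield" where
  "vf_scale u X = (\<lambda>f p. u p * X f p)"

definition lie_bracket :: "'a vfield \<Rightarrow> 'a vfield \<Rightarrow> 'a vfield" where
  "lie_bracket X Y = (\<lambda>f p. X (Y f) p - Y (X f) p)"

section \<open>Tensor fields\<close>

text \<open>Tensor fields are maps on vector fields that are multilinear over the smooth functions. The
  value of such a map at a point depends only on the values of its arguments at that point.\<close>

definition one_forms :: "('a, 'e::euclidean_space) atlas \<Rightarrow> ('a vfield \<Rightarrow> 'a \<Rightarrow> real) set" where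
  "one_forms A = {\<eta>.
     (\<forall>X\<in>vector_fields A. \<eta> X \<in> smooth_functions A) \<and>
     (\<forall>X\<in>vector_fields A. \<forall>Y\<in>vector_fields A. \<eta> (vf_add X Y) = (\<lambda>p. \<eta> X p + \<eta> Y p)) \<and>
     (\<forall>u\<in>smooth_functions A. \<forall>X\<in>vector_fields A. \<eta> (vf_scale u X) = (\<lambda>p. u p * \<eta> X p))}"

definition endomorphism_fields ::
  "('a, 'e::euclidean_space) atlas \<Rightarrow> ('a vfield \<Rightarrow> 'a vfield) set" where
  "endomorphism_fields A = {\<phi>.
     (\<forall>X\<in>vector_fields A. \<phi> X \<in> vector_fields A) \<and>
     (\<forall>X\<in>vector_fields A. \<forall>Y\<in>vector_fields A. \<phi> (vf_add X Y) = vf_add (\<phi> X) (\<phi> Y)) \<and>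
     (\<forall>u\<in>smooth_functions A. \<forall>X\<in>vector_fields A. \<phi> (vf_scale u X) = vf_scale u (\<phi> X))}"

text \<open>The index of the metric is not mentioned: on a connected manifold it is constant.\<close>
definition semi_riemannian_metric ::
  "('a, 'e::euclidean_space) atlas \<Rightarrow> ('a vfield \<Rightarrow> 'a vfield \<Rightarrow> 'a \<Rightarrow> real) \<Rightarrow> bool" where
  "semi_riemannian_metric A g \<longleftrightarrow>
     (\<forall>X\<in>vector_fields A. g X \<in> one_forms A) \<and>
     (\<forall>X\<in>vector_fields A. \<forall>Y\<in>vector_fields A. g X Y = g Y X) \<and>
     (\<forall>p. \<forall>X\<in>vector_fields A. (\<forall>Y\<in>vector_fields A. g X Y p = 0) \<longrightarrow>
        (\<forall>f\<in>smooth_functions A. X f p = 0))"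

section \<open>Exterior calculus\<close>

text \<open>A differential form of degree \<open>k\<close> is a function of the first \<open>k\<close> members of a sequence of
  vector fields. The normalisation of \<open>wedge\<close> is the one matching the factor one half in
  \<open>ext_deriv\<close>.\<close>

definition wedge :: "nat \<Rightarrow> nat \<Rightarrow> ((nat \<Rightarrow> 'a vfield) \<Rightarrow> 'a \<Rightarrow> real) \<Rightarrow>
    ((nat \<Rightarrow> 'a vfield) \<Rightarrow> 'a \<Rightarrow> real) \<Rightarrow> (nat \<Rightarrow> 'a vfield) \<Rightarrow> 'a \<Rightarrow> real" where
  "wedge k l \<alpha> \<beta> X p =
     (\<Sum>\<sigma> | \<sigma> permutes {..<k + l}.
        of_int (sign \<sigma>) * \<alpha> (\<lambda>i. X (\<sigma> i)) p * \<beta> (\<lambda>i. X (\<sigma> (k + i))) p) / fact (k + l)"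

primrec wedge_power_2 :: "((nat \<Rightarrow> 'a vfield) \<Rightarrow> 'a \<Rightarrow> real) \<Rightarrow> nat \<Rightarrow>
    (nat \<Rightarrow> 'a vfield) \<Rightarrow> 'a \<Rightarrow> real" where
  "wedge_power_2 \<omega> 0 = (\<lambda>X p. 1)"
| "wedge_power_2 \<omega> (Suc n) = wedge 2 (2 * n) \<omega> (wedge_power_2 \<omega> n)"

definition ext_deriv :: "('a vfield \<Rightarrow> 'a \<Rightarrow> real) \<Rightarrow> 'a vfield \<Rightarrow> 'a vfield \<Rightarrow> 'a \<Rightarrow> real" where
  "ext_deriv \<eta> X Y = (\<lambda>p. (X (\<eta> Y) p - Y (\<eta> X) p - \<eta> (lie_bracket X Y) p) / 2)"

definition contact_form ::
  "('a, 'e::euclidean_space) atlas \<Rightarrow> nat \<Rightarrow> ('a vfield \<Rightarrow> 'a \<Rightarrow> real) \<Rightarrow> bool" where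
  "contact_form A n \<eta> \<longleftrightarrow>
     DIM('e) = 2 * n + 1 \<and> \<eta> \<in> one_forms A \<and>
     (\<forall>p. \<exists>X. (\<forall>i. X i \<in> vector_fields A) \<and>
        wedge 1 (2 * n) (\<lambda>X. \<eta> (X 0))
          (wedge_power_2 (\<lambda>X. ext_deriv \<eta> (X 0) (X 1)) n) X p \<noteq> 0)"

definition reeb_field ::
  "('a, 'e::euclidean_space) atlas \<Rightarrow> ('a vfield \<Rightarrow> 'a \<Rightarrow> real) \<Rightarrow> 'a vfield \<Rightarrow> bool" where
  "reeb_field A \<eta> \<xi> \<longleftrightarrow>
     \<xi> \<in> vector_fields A \<and> \<eta> \<xi> = (\<lambda>p. 1) \<and>
     (\<forall>X\<in>vector_fields A. ext_deriv \<eta> \<xi> X = (\<lambda>p. 0))"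

section \<open>Paracontact metric structures\<close>

definition paracontact_metric_manifold ::
  "('a::{t2_space,second_countable_topology}, 'e::euclidean_space) atlas \<Rightarrow> nat \<Rightarrow>
   ('a vfield \<Rightarrow> 'a vfield) \<Rightarrow> 'a vfield \<Rightarrow> ('a vfield \<Rightarrow> 'a \<Rightarrow> real) \<Rightarrow>
   ('a vfield \<Rightarrow> 'a vfield \<Rightarrow> 'a \<Rightarrow> real) \<Rightarrow> bool" where
  "paracontact_metric_manifold A n \<phi> \<xi> \<eta> g \<longleftrightarrow>
     smooth_manifold A \<and> contact_form A n \<eta> \<and> reeb_field A \<eta> \<xi> \<and>
     semi_riemannian_metric A g \<and> \<phi> \<in> endomorphism_fields A \<and>
     (\<forall>X\<in>vector_fields A. \<eta> X = g \<xi> X) \<and>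
     (\<forall>X\<in>vector_fields A. \<forall>Y\<in>vector_fields A. ext_deriv \<eta> X Y = g X (\<phi> Y)) \<and>
     (\<forall>X\<in>vector_fields A. \<phi> (\<phi> X) = vf_diff X (vf_scale (\<eta> X) \<xi>))"

definition lie_deriv_metric :: "'a vfield \<Rightarrow> ('a vfield \<Rightarrow> 'a vfield \<Rightarrow> 'a \<Rightarrow> real) \<Rightarrow>
    'a vfield \<Rightarrow> 'a vfield \<Rightarrow> 'a \<Rightarrow> real" where
  "lie_deriv_metric V g X Y =
     (\<lambda>p. V (g X Y) p - g (lie_bracket V X) Y p - g X (lie_bracket V Y) p)"

definition killing_field :: "('a, 'e::euclidean_space) atlas \<Rightarrow>
    ('a vfield \<Rightarrow> 'a vfield \<Rightarrow> 'a \<Rightarrow> real) \<Rightarrow> 'a vfield \<Rightarrow> bool" where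
  "killing_field A g V \<longleftrightarrow> V \<in> vector_fields A \<and>
     (\<forall>X\<in>vector_fields A. \<forall>Y\<in>vector_fields A. lie_deriv_metric V g X Y = (\<lambda>p. 0))"

definition K_paracontact_manifold ::
  "('a::{t2_space,second_countable_topology}, 'e::euclidean_space) atlas \<Rightarrow> nat \<Rightarrow>
   ('a vfield \<Rightarrow> 'a vfield) \<Rightarrow> 'a vfield \<Rightarrow> ('a vfield \<Rightarrow> 'a \<Rightarrow> real) \<Rightarrow>
   ('a vfield \<Rightarrow> 'a vfield \<Rightarrow> 'a \<Rightarrow> real) \<Rightarrow> bool" where
  "K_paracontact_manifold A n \<phi> \<xi> \<eta> g \<longleftrightarrow>
     paracontact_metric_manifold A n \<phi> \<xi> \<eta> g \<and> killing_field A g \<xi>"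

section \<open>Levi-Civita connection and infinitesimal harmonic transformations\<close>

definition affine_connection :: "('a, 'e::euclidean_space) atlas \<Rightarrow>
    ('a vfield \<Rightarrow> 'a vfield \<Rightarrow> 'a vfield) \<Rightarrow> bool" where
  "affine_connection A D \<longleftrightarrow>
     (\<forall>X\<in>vector_fields A. \<forall>Y\<in>vector_fields A. D X Y \<in> vector_fields A) \<and>
     (\<forall>X\<in>vector_fields A. \<forall>Y\<in>vector_fields A. \<forall>Z\<in>vector_fields A.
        D (vf_add X Y) Z = vf_add (D X Z) (D Y Z) \<and>
        D X (vf_add Y Z) = vf_add (D X Y) (D X Z)) \<and>
     (\<forall>u\<in>smooth_functions A. \<forall>X\<in>vector_fields A. \<forall>Y\<in>vector_fields A.
        D (vf_scale u X) Y = vf_scale u (D X Y) \<and>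
        D X (vf_scale u Y) = vf_add (vf_scale (X u) Y) (vf_scale u (D X Y)))"

text \<open>For a semi-Riemannian metric there is exactly one such connection (up to its irrelevant values
  on arguments that are not vector fields).\<close>
definition levi_civita :: "('a, 'e::euclidean_space) atlas \<Rightarrow>
    ('a vfield \<Rightarrow> 'a vfield \<Rightarrow> 'a \<Rightarrow> real) \<Rightarrow> ('a vfield \<Rightarrow> 'a vfield \<Rightarrow> 'a vfield) \<Rightarrow> bool" where
  "levi_civita A g D \<longleftrightarrow> affine_connection A D \<and>
     (\<forall>X\<in>vector_fields A. \<forall>Y\<in>vector_fields A. vf_diff (D X Y) (D Y X) = lie_bracket X Y) \<and>
     (\<forall>X\<in>vector_fields A. \<forall>Y\<in>vector_fields A. \<forall>Z\<in>vector_fields A.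
        X (g Y Z) = (\<lambda>p. g (D X Y) Z p + g Y (D X Z) p))"

definition lie_deriv_connection :: "'a vfield \<Rightarrow> ('a vfield \<Rightarrow> 'a vfield \<Rightarrow> 'a vfield) \<Rightarrow>
    'a vfield \<Rightarrow> 'a vfield \<Rightarrow> 'a vfield" where
  "lie_deriv_connection V D X Y =
     vf_diff (vf_diff (lie_bracket V (D X Y)) (D (lie_bracket V X) Y)) (D X (lie_bracket V Y))"

definition pseudo_orthonormal_at :: "('a, 'e::euclidean_space) atlas \<Rightarrow>
    ('a vfield \<Rightarrow> 'a vfield \<Rightarrow> 'a \<Rightarrow> real) \<Rightarrow> 'a \<Rightarrow> (nat \<Rightarrow> 'a vfield) \<Rightarrow> bool" where
  "pseudo_orthonormal_at A g p E \<longleftrightarrow>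
     (\<forall>i<DIM('e). E i \<in> vector_fields A \<and> (g (E i) (E i) p = 1 \<or> g (E i) (E i) p = -1)) \<and>
     (\<forall>i<DIM('e). \<forall>j<DIM('e). i \<noteq> j \<longrightarrow> g (E i) (E j) p = 0)"

text \<open>The trace at \<open>p\<close> of a tensor \<open>T\<close> with values in vector fields is the sum of
  \<open>g (E i) (E i) p\<close> times the tangent vector of \<open>T (E i) (E i)\<close> at \<open>p\<close>, for a pseudo-orthonormal
  basis \<open>E\<close> of the tangent space at \<open>p\<close>, of which the fields \<open>E i\<close> are global extensions. Such
  fields exist at every point, and neither the basis nor the extensions matter.\<close>
definition metric_trace_zero :: "('a, 'e::euclidean_space) atlas \<Rightarrow>
    ('a vfield \<Rightarrow> 'a vfield \<Rightarrow> 'a \<Rightarrow> real) \<Rightarrow> ('a vfield \<Rightarrow> 'a vfield \<Rightarrow> 'a vfield) \<Rightarrow> bool" where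
  "metric_trace_zero A g T \<longleftrightarrow>
     (\<forall>p E. pseudo_orthonormal_at A g p E \<longrightarrow>
        (\<forall>f\<in>smooth_functions A. (\<Sum>i<DIM('e). g (E i) (E i) p * T (E i) (E i) f p) = 0))"

text \<open>The connection is an explicit argument, required to be the Levi-Civita connection of \<open>g\<close>.\<close>
definition infinitesimal_harmonic :: "('a, 'e::euclidean_space) atlas \<Rightarrow>
    ('a vfield \<Rightarrow> 'a vfield \<Rightarrow> 'a \<Rightarrow> real) \<Rightarrow> ('a vfield \<Rightarrow> 'a vfield \<Rightarrow> 'a vfield) \<Rightarrow>
    'a vfield \<Rightarrow> bool" where
  "infinitesimal_harmonic A g D V \<longleftrightarrow>
     levi_civita A g D \<and> V \<in> vector_fields A \<and> metric_trace_zero A g (lie_deriv_connection V D)"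

end

theory Submission imports Defs begin

text \<open>For a Killing field \<open>V\<close> the tensor \<open>T = L\<^sub>V \<nabla>\<close> is symmetric in its two arguments because
  \<open>\<nabla>\<close> is torsion-free, and \<open>g(T(X, Y), Z)\<close> is skew in \<open>Y, Z\<close> because \<open>\<nabla>\<close> is metric and \<open>V\<close>
  preserves \<open>g\<close>; a trilinear form with these two symmetries vanishes.

  The example is \<open>\<real>\<^sup>3\<close> with the frame \<open>U = \<partial>\<^sub>1 + x\<^sub>3 \<partial>\<^sub>2 - 2 x\<^sub>2 \<partial>\<^sub>3\<close>, \<open>W = \<partial>\<^sub>2\<close>, \<open>\<xi> = \<partial>\<^sub>3\<close>, where
  \<open>g(U, W) = g(\<xi>, \<xi>) = 1\<close> and all other products vanish, \<open>\<phi> U = U\<close>, \<open>\<phi> W = -W\<close>. Since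
  \<open>[\<xi>, U] = W\<close>, the operator \<open>h\<close> is nilpotent but not zero, so \<open>\<xi>\<close> is not Killing. The only
  components of \<open>L\<^sub>\<xi> \<nabla>\<close> that do not vanish are those on \<open>(U, \<xi>)\<close> and \<open>(\<xi>, U)\<close>, and they do not
  contribute to the trace because the metric dual of \<open>U\<close> is \<open>W\<close>, which is orthogonal to \<open>\<xi>\<close>.\<close>

section \<open>Smooth functions\<close>

text \<open>A derivative at \<open>x\<close> depends on the values near \<open>x\<close>, so
  agreement on \<open>S\<close> carries over to derivatives because \<open>S\<close> is open. This
  is what allows the derivative of a sum or product to be replaced by its explicit formula inside
  \<open>Ck_on\<close>.\<close>

lemma Ck_on_cong:
  assumes "open S" "\<And>x. x \<in> S \<Longrightarrow> f x = g x" "Ck_on k S f"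
  shows "Ck_on k S g"
  using assms(2,3)
proof (induction k arbitrary: f g)
  case 0
  then show ?case by (simp cong: continuous_on_cong)
next
  case (Suc k)
  have deriv: "(g has_derivative frechet_derivative f (at x)) (at x)" if "x \<in> S" for x
    using that Suc.prems \<open>open S\<close>
    by (intro has_derivative_transform_within_open[of f _ x UNIV S g])
      (auto simp: frechet_derivative_works)
  then have eq: "frechet_derivative f (at x) = frechet_derivative g (at x)" if "x \<in> S" for x
    using that frechet_derivative_at by blast
  have "Ck_on k S (\<lambda>x. frechet_derivative g (at x) v)" for v
    by (rule Suc.IH[of "\<lambda>x. frechet_derivative f (at x) v"]) (use eq Suc.prems in auto)
  with deriv show ?case by (auto simp: differentiable_def)
qed

lemma Ck_on_const: "Ck_on k S (\<lambda>x. c)"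
  by (induction k arbitrary: c) auto

lemma Ck_on_add:
  assumes "open S" "Ck_on k S f" "Ck_on k S g"
  shows "Ck_on k S (\<lambda>x. f x + g x)"
  using assms(2,3)
proof (induction k arbitrary: f g)
  case 0
  then show ?case by (simp add: continuous_on_add)
next
  case (Suc k)
  have "Ck_on k S (\<lambda>x. frechet_derivative (\<lambda>x. f x + g x) (at x) v)" for v
  proof (rule Ck_on_cong[OF \<open>open S\<close>])
    show "Ck_on k S (\<lambda>x. frechet_derivative f (at x) v + frechet_derivative g (at x) v)"
      using Suc by auto
    fix x assume "x \<in> S"
    then have "((\<lambda>x. f x + g x) has_derivative
        (\<lambda>v. frechet_derivative f (at x) v + frechet_derivative g (at x) v)) (at x)"
      using Suc.prems by (intro has_derivative_add) (auto simp: frechet_derivative_works)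
    from frechet_derivative_at[OF this]
    show "frechet_derivative f (at x) v + frechet_derivative g (at x) v =
        frechet_derivative (\<lambda>x. f x + g x) (at x) v"
      by metis
  qed
  with Suc.prems show ?case by auto
qed

lemma smooth_on_differentiable: "smooth_on S f \<Longrightarrow> x \<in> S \<Longrightarrow> f differentiable (at x)"
  unfolding smooth_on_def by (metis Ck_on.simps(2))

lemma smooth_on_frechet_derivative:
  "smooth_on S f \<Longrightarrow> smooth_on S (\<lambda>x. frechet_derivative f (at x) v)"
  unfolding smooth_on_def by (metis Ck_on.simps(2))

lemma smooth_on_has_derivative:
  "smooth_on S f \<Longrightarrow> x \<in> S \<Longrightarrow> (f has_derivative frechet_derivative f (at x)) (at x)"
  using frechet_derivative_works smooth_on_differentiable by blast

lemma smooth_on_continuous_on: "smooth_on S f \<Longrightarrow> continuous_on S f"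
  unfolding smooth_on_def by (metis Ck_on.simps(1))

lemma smooth_on_const: "smooth_on S (\<lambda>x. c)"
  by (simp add: smooth_on_def Ck_on_const)

lemma smooth_on_add:
  "open S \<Longrightarrow> smooth_on S f \<Longrightarrow> smooth_on S g \<Longrightarrow> smooth_on S (\<lambda>x. f x + g x)"
  by (simp add: smooth_on_def Ck_on_add)

text \<open>The derivative at every point is \<open>f\<close> itself, so each directional derivative
  is a constant function.\<close>

lemma smooth_on_bounded_linear:
  assumes "bounded_linear f"
  shows "smooth_on S f"
proof -
  have eq: "frechet_derivative f (at x) = f" for x
    using assms bounded_linear_imp_has_derivative frechet_derivative_at by metis
  have "Ck_on k S f" for k
    using assms
    by (cases k) (auto simp: eq Ck_on_const linear_continuous_on
        intro: bounded_linear_imp_differentiable)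
  then show ?thesis by (simp add: smooth_on_def)
qed

text \<open>The Leibniz rule mixes derivatives with the undifferentiated factors. Keeping both
  factors smooth throughout the induction, rather than of class \<open>k\<close>, lets the induction
  hypothesis apply to either kind of product.\<close>

lemma smooth_on_mult:
  fixes f g :: "'a::real_normed_vector \<Rightarrow> real"
  assumes "open S" "smooth_on S f" "smooth_on S g"
  shows "smooth_on S (\<lambda>x. f x * g x)"
proof -
  have "Ck_on k S (\<lambda>x. f x * g x)" for k
    using assms(2,3)
  proof (induction k arbitrary: f g)
    case 0
    then show ?case by (simp add: continuous_on_mult smooth_on_continuous_on)
  next
    case (Suc k)
    have "Ck_on k S (\<lambda>x. frechet_derivative (\<lambda>x. f x * g x) (at x) v)" for v
    proof (rule Ck_on_cong[OF \<open>open S\<close>])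
      show "Ck_on k S (\<lambda>x. f x * frechet_derivative g (at x) v + frechet_derivative f (at x) v * g x)"
        using Suc by (intro Ck_on_add assms(1) Suc.IH smooth_on_frechet_derivative)
      fix x assume "x \<in> S"
      then have "((\<lambda>x. f x * g x) has_derivative
          (\<lambda>v. f x * frechet_derivative g (at x) v + frechet_derivative f (at x) v * g x)) (at x)"
        using Suc.prems by (intro has_derivative_mult smooth_on_has_derivative)
      from frechet_derivative_at[OF this]
      show "f x * frechet_derivative g (at x) v + frechet_derivative f (at x) v * g x =
          frechet_derivative (\<lambda>x. f x * g x) (at x) v"
        by metis
    qed
    with Suc.prems show ?case by (simp add: differentiable_mult smooth_on_differentiable)
  qed
  then show ?thesis by (simp add: smooth_on_def)
qed

section \<open>Vector fields as derivations\<close>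

text \<open>Openness of the chart images is what closure of the smooth functions under sums and
  products rests on; the algebra of derivations builds on that closure.\<close>

locale open_atlas =
  fixes A :: "('a, 'e::euclidean_space) atlas"
  assumes open_chart: "(U, \<psi>) \<in> A \<Longrightarrow> open (\<psi> ` U)"
begin

lemma smooth_functions_const: "(\<lambda>p. c) \<in> smooth_functions A"
  by (auto simp: smooth_functions_def o_def smooth_on_const)

lemma smooth_functions_add:
  "f \<in> smooth_functions A \<Longrightarrow> h \<in> smooth_functions A \<Longrightarrow> (\<lambda>p. f p + h p) \<in> smooth_functions A"
  by (auto simp: smooth_functions_def o_def intro!: smooth_on_add open_chart)

lemma smooth_functions_mult:
  "f \<in> smooth_functions A \<Longrightarrow> h \<in> smooth_functions A \<Longrightarrow> (\<lambda>p. f p * h p) \<in> smooth_functions A"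
  by (auto simp: smooth_functions_def o_def intro!: smooth_on_mult open_chart)

lemma smooth_functions_minus:
  "f \<in> smooth_functions A \<Longrightarrow> (\<lambda>p. - f p) \<in> smooth_functions A"
  using smooth_functions_mult[OF smooth_functions_const[of "-1"]] by simp

lemma smooth_functions_diff:
  "f \<in> smooth_functions A \<Longrightarrow> h \<in> smooth_functions A \<Longrightarrow> (\<lambda>p. f p - h p) \<in> smooth_functions A"
  using smooth_functions_add[OF _ smooth_functions_minus] by simp

lemmas smooth_functions_intros = smooth_functions_const smooth_functions_add
  smooth_functions_mult smooth_functions_minus smooth_functions_diff

lemma vector_fields_smooth:
  "X \<in> vector_fields A \<Longrightarrow> f \<in> smooth_functions A \<Longrightarrow> X f \<in> smooth_functions A"
  by (simp add: vector_fields_def)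

lemma vector_fields_outside:
  "X \<in> vector_fields A \<Longrightarrow> f \<notin> smooth_functions A \<Longrightarrow> X f = (\<lambda>p. 0)"
  by (simp add: vector_fields_def)

lemma derivation_add:
  "X \<in> vector_fields A \<Longrightarrow> f \<in> smooth_functions A \<Longrightarrow> h \<in> smooth_functions A \<Longrightarrow>
    X (\<lambda>p. f p + h p) = (\<lambda>p. X f p + X h p)"
  by (simp add: vector_fields_def)

lemma derivation_scale:
  "X \<in> vector_fields A \<Longrightarrow> f \<in> smooth_functions A \<Longrightarrow> X (\<lambda>p. c * f p) = (\<lambda>p. c * X f p)"
  by (simp add: vector_fields_def)

lemma derivation_mult:
  "X \<in> vector_fields A \<Longrightarrow> f \<in> smooth_functions A \<Longrightarrow> h \<in> smooth_functions A \<Longrightarrow>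
    X (\<lambda>p. f p * h p) = (\<lambda>p. X f p * h p + f p * X h p)"
  by (simp add: vector_fields_def)

lemma derivation_minus:
  "X \<in> vector_fields A \<Longrightarrow> f \<in> smooth_functions A \<Longrightarrow> X (\<lambda>p. - f p) = (\<lambda>p. - X f p)"
  using derivation_scale[of X f "-1"] by simp

lemma derivation_diff:
  "X \<in> vector_fields A \<Longrightarrow> f \<in> smooth_functions A \<Longrightarrow> h \<in> smooth_functions A \<Longrightarrow>
    X (\<lambda>p. f p - h p) = (\<lambda>p. X f p - X h p)"
  using derivation_add[of X f "\<lambda>p. - h p"] by (simp add: derivation_minus smooth_functions_minus)

lemma derivation_const:
  assumes "X \<in> vector_fields A"
  shows "X (\<lambda>p. c) = (\<lambda>p. 0)"
proof -
  \<comment> \<open>The Leibniz rule on 1 = 1 * 1 gives X 1 = 2 X 1.\<close>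
  have "X (\<lambda>p. 1 * 1) = (\<lambda>p. X (\<lambda>p. 1) p * 1 + 1 * X (\<lambda>p. 1) p)"
    using assms by (rule derivation_mult) (rule smooth_functions_const)+
  then have "X (\<lambda>p. 1) = (\<lambda>p. 0)" by (simp add: fun_eq_iff)
  with derivation_scale[OF assms smooth_functions_const[of 1], of c] show ?thesis by simp
qed

lemmas derivation_simps = derivation_add derivation_mult derivation_minus derivation_diff
  derivation_const

lemma derivation_sum:
  assumes "X \<in> vector_fields A" "finite I" "\<And>i. i \<in> I \<Longrightarrow> f i \<in> smooth_functions A"
  shows "(\<lambda>p. \<Sum>i\<in>I. f i p) \<in> smooth_functions A"
    and "X (\<lambda>p. \<Sum>i\<in>I. f i p) = (\<lambda>p. \<Sum>i\<in>I. X (f i) p)"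
proof -
  have "(\<lambda>p. \<Sum>i\<in>I. f i p) \<in> smooth_functions A \<and>
      X (\<lambda>p. \<Sum>i\<in>I. f i p) = (\<lambda>p. \<Sum>i\<in>I. X (f i) p)"
    using assms(2,3)
  proof (induction I rule: finite_induct)
    case empty
    then show ?case by (simp add: smooth_functions_const derivation_const[OF assms(1)])
  next
    case (insert i I)
    then show ?case
      by (simp add: smooth_functions_add derivation_add[OF assms(1)])
  qed
  then show "(\<lambda>p. \<Sum>i\<in>I. f i p) \<in> smooth_functions A"
    and "X (\<lambda>p. \<Sum>i\<in>I. f i p) = (\<lambda>p. \<Sum>i\<in>I. X (f i) p)" by auto
qed

section \<open>Closure of vector fields under module operations and bracket\<close>

lemma vector_fieldsI:
  assumes "\<And>f. f \<in> smooth_functions A \<Longrightarrow> X f \<in> smooth_functions A"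
    and "\<And>f. f \<notin> smooth_functions A \<Longrightarrow> X f = (\<lambda>p. 0)"
    and "\<And>f h p. f \<in> smooth_functions A \<Longrightarrow> h \<in> smooth_functions A \<Longrightarrow>
        X (\<lambda>p. f p + h p) p = X f p + X h p"
    and "\<And>f h p. f \<in> smooth_functions A \<Longrightarrow> h \<in> smooth_functions A \<Longrightarrow>
        X (\<lambda>p. f p * h p) p = X f p * h p + f p * X h p"
    and "\<And>c f p. f \<in> smooth_functions A \<Longrightarrow> X (\<lambda>p. c * f p) p = c * X f p"
  shows "X \<in> vector_fields A"
  unfolding vector_fields_def using assms by (auto intro!: ext)

lemma vf_add_vector_fields:
  "X \<in> vector_fields A \<Longrightarrow> Y \<in> vector_fields A \<Longrightarrow> vf_add X Y \<in> vector_fields A"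
  by (rule vector_fieldsI)
    (simp_all add: vf_add_def smooth_functions_intros vector_fields_smooth vector_fields_outside
      derivation_add derivation_mult derivation_scale algebra_simps)

lemma vf_scale_vector_fields:
  "u \<in> smooth_functions A \<Longrightarrow> X \<in> vector_fields A \<Longrightarrow> vf_scale u X \<in> vector_fields A"
  by (rule vector_fieldsI)
    (simp_all add: vf_scale_def smooth_functions_intros vector_fields_smooth vector_fields_outside
      derivation_add derivation_mult derivation_scale algebra_simps)

lemma vf_diff_conv: "vf_diff X Y = vf_add X (vf_scale (\<lambda>p. -1) Y)"
  by (simp add: vf_diff_def vf_add_def vf_scale_def)

lemma vf_diff_vector_fields:
  "X \<in> vector_fields A \<Longrightarrow> Y \<in> vector_fields A \<Longrightarrow> vf_diff X Y \<in> vector_fields A"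
  by (simp add: vf_diff_conv vf_add_vector_fields vf_scale_vector_fields smooth_functions_const)

text \<open>In the Leibniz rule for \<open>X (Y (f h))\<close> the mixed products of first
  derivatives are symmetric in \<open>X\<close> and \<open>Y\<close>, so they cancel in the
  commutator.\<close>

lemma lie_bracket_vector_fields:
  assumes X: "X \<in> vector_fields A" and Y: "Y \<in> vector_fields A"
  shows "lie_bracket X Y \<in> vector_fields A"
  by (rule vector_fieldsI)
    (simp_all add: X Y lie_bracket_def smooth_functions_intros vector_fields_smooth
      vector_fields_outside derivation_simps[OF X] derivation_simps[OF Y]
      derivation_scale[OF X] derivation_scale[OF Y] algebra_simps)

lemmas vector_fields_intros = vf_add_vector_fields vf_scale_vector_fields vf_diff_vector_fields
  lie_bracket_vector_fields

lemma lie_deriv_connection_vector_fields: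
  "affine_connection A D \<Longrightarrow> V \<in> vector_fields A \<Longrightarrow> X \<in> vector_fields A \<Longrightarrow>
    Y \<in> vector_fields A \<Longrightarrow> lie_deriv_connection V D X Y \<in> vector_fields A"
  by (simp add: lie_deriv_connection_def affine_connection_def vector_fields_intros)

end

section \<open>Killing fields preserve the Levi-Civita connection\<close>

context open_atlas begin

lemma metric_sym:
  "semi_riemannian_metric A g \<Longrightarrow> X \<in> vector_fields A \<Longrightarrow> Y \<in> vector_fields A \<Longrightarrow> g X Y = g Y X"
  by (simp add: semi_riemannian_metric_def)

lemma metric_smooth:
  "semi_riemannian_metric A g \<Longrightarrow> X \<in> vector_fields A \<Longrightarrow> Y \<in> vector_fields A \<Longrightarrow>
    g X Y \<in> smooth_functions A"
  by (simp add: semi_riemannian_metric_def one_forms_def)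

lemma metric_diff_right:
  assumes "semi_riemannian_metric A g" "Z \<in> vector_fields A"
    "X \<in> vector_fields A" "Y \<in> vector_fields A"
  shows "g Z (vf_diff X Y) p = g Z X p - g Z Y p"
proof -
  have "g Z \<in> one_forms A" using assms by (simp add: semi_riemannian_metric_def)
  moreover have "vf_scale (\<lambda>p. -1) Y \<in> vector_fields A"
    using assms by (simp add: vf_scale_vector_fields smooth_functions_const)
  ultimately show ?thesis
    using assms by (simp add: vf_diff_conv one_forms_def smooth_functions_const)
qed

lemma metric_diff_left:
  assumes "semi_riemannian_metric A g" "Z \<in> vector_fields A"
    "X \<in> vector_fields A" "Y \<in> vector_fields A"
  shows "g (vf_diff X Y) Z p = g X Z p - g Y Z p"
  using metric_diff_right[OF assms] metric_sym[OF assms(1,2)] assms vf_diff_vector_fields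
  by metis

text \<open>Exchanging the arguments of \<open>D\<close> costs a bracket, since the torsion is zero.
  The brackets collected this way are [V, [X, Y]] - [[V, X], Y] - [X, [V, Y]], which is zero by the
  Jacobi identity.\<close>

lemma lie_deriv_connection_sym:
  assumes "levi_civita A g D" "V \<in> vector_fields A" "X \<in> vector_fields A" "Y \<in> vector_fields A"
  shows "lie_deriv_connection V D X Y = lie_deriv_connection V D Y X"
proof (intro ext)
  fix f p
  have D: "D X Y \<in> vector_fields A" if "X \<in> vector_fields A" "Y \<in> vector_fields A" for X Y
    using assms(1) that by (simp add: levi_civita_def affine_connection_def)
  show "lie_deriv_connection V D X Y f p = lie_deriv_connection V D Y X f p"
  \<comment> \<open>Equality of vector fields also concerns non-smooth functions, on which every
    vector field is zero.\<close>
  proof (cases "f \<in> smooth_functions A")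
    case False
    then show ?thesis
      using assms D by (simp add: lie_deriv_connection_def vf_diff_def vector_fields_outside
          lie_bracket_vector_fields)
  next
    case True
    have tf: "D X Y f = (\<lambda>p. D Y X f p + (X (Y f) p - Y (X f) p))"
      if "X \<in> vector_fields A" "Y \<in> vector_fields A" for X Y f
    proof -
      have "vf_diff (D X Y) (D Y X) = lie_bracket X Y"
        using assms(1) that by (simp add: levi_civita_def)
      then have "D X Y f p - D Y X f p = X (Y f) p - Y (X f) p" for p
        unfolding vf_diff_def lie_bracket_def by metis
      then show ?thesis by (simp add: fun_eq_iff algebra_simps)
    qed
    show ?thesis
      unfolding lie_deriv_connection_def vf_diff_def lie_bracket_def[of V "D _ _"]
      \<comment> \<open>As a rewrite rule \<open>tf\<close> would swap the arguments back and forth,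
        so it is applied to chosen terms: \<open>D X Y\<close> on \<open>f\<close> and on
        \<open>V f\<close>, then the two terms containing a bracket with \<open>V\<close>.\<close>
      apply (subst tf[of X Y], fact, fact)
      apply (subst tf[of X Y], fact, fact)
      apply (subst tf[of "lie_bracket V X" Y], simp add: assms lie_bracket_vector_fields, fact)
      apply (subst tf[of X "lie_bracket V Y"], fact, simp add: assms lie_bracket_vector_fields)
      using assms True D
      by (simp add: lie_bracket_def derivation_simps[OF assms(2)] derivation_simps[OF assms(3)]
          derivation_simps[OF assms(4)] smooth_functions_intros vector_fields_smooth)
  qed
qed

text \<open>The commutator of \<open>V\<close> and \<open>X\<close> on the function
  \<open>g Y Z\<close> is computed in two ways: by expanding both orders with the Killing equation
  and metric compatibility, and by applying compatibility to the field [V, X]. The terms in which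
  \<open>V\<close> hits one argument and \<open>X\<close> the other cancel.\<close>

lemma lie_deriv_connection_skew:
  assumes g: "semi_riemannian_metric A g" and lc: "levi_civita A g D" and kf: "killing_field A g V"
    and X: "X \<in> vector_fields A" and Y: "Y \<in> vector_fields A" and Z: "Z \<in> vector_fields A"
  shows "g (lie_deriv_connection V D X Y) Z p = - g Y (lie_deriv_connection V D X Z) p"
proof -
  have V: "V \<in> vector_fields A" using kf by (simp add: killing_field_def)
  have D: "D X Y \<in> vector_fields A" if "X \<in> vector_fields A" "Y \<in> vector_fields A" for X Y
    using lc that by (simp add: levi_civita_def affine_connection_def)
  have compat: "X (g Y Z) = (\<lambda>p. g (D X Y) Z p + g Y (D X Z) p)"
    if "X \<in> vector_fields A" "Y \<in> vector_fields A" "Z \<in> vector_fields A" for X Y Z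
    using lc that by (simp add: levi_civita_def)
  have kill: "V (g X Y) = (\<lambda>p. g (lie_bracket V X) Y p + g X (lie_bracket V Y) p)"
    if "X \<in> vector_fields A" "Y \<in> vector_fields A" for X Y
  proof -
    have "lie_deriv_metric V g X Y = (\<lambda>p. 0)"
      using kf that by (simp add: killing_field_def)
    then show ?thesis by (simp add: lie_deriv_metric_def fun_eq_iff algebra_simps)
  qed
  note cl = V X Y Z D vector_fields_intros metric_smooth[OF g]
  have "V (X (g Y Z)) p = g (lie_bracket V (D X Y)) Z p + g (D X Y) (lie_bracket V Z) p
      + g (lie_bracket V Y) (D X Z) p + g Y (lie_bracket V (D X Z)) p"
    using cl by (simp add: compat[OF X] derivation_add[OF V] kill)
  moreover have "X (V (g Y Z)) p = g (D X (lie_bracket V Y)) Z p + g (lie_bracket V Y) (D X Z) p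
      + g (D X Y) (lie_bracket V Z) p + g Y (D X (lie_bracket V Z)) p"
    using cl by (simp add: compat[OF X] derivation_add[OF X] kill)
  moreover have "V (X (g Y Z)) p - X (V (g Y Z)) p =
      g (D (lie_bracket V X) Y) Z p + g Y (D (lie_bracket V X) Z) p"
    using compat[of "lie_bracket V X" Y Z] cl by (simp add: lie_bracket_def fun_eq_iff)
  ultimately show ?thesis
    using cl by (simp add: lie_deriv_connection_def metric_diff_left[OF g] metric_diff_right[OF g])
qed

lemma lie_deriv_connection_killing:
  assumes g: "semi_riemannian_metric A g" and lc: "levi_civita A g D" and kf: "killing_field A g V"
    and X: "X \<in> vector_fields A" and Y: "Y \<in> vector_fields A" and f: "f \<in> smooth_functions A"
  shows "lie_deriv_connection V D X Y f p = 0"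
proof -
  let ?T = "lie_deriv_connection V D"
  have V: "V \<in> vector_fields A" using kf by (simp add: killing_field_def)
  have T: "?T X Y \<in> vector_fields A" if "X \<in> vector_fields A" "Y \<in> vector_fields A" for X Y
    using lc V that by (simp add: levi_civita_def lie_deriv_connection_vector_fields)
  let ?S = "\<lambda>X Y Z. g (?T X Y) Z p"
  have sym: "?S X Y Z = ?S Y X Z"
    if "X \<in> vector_fields A" "Y \<in> vector_fields A" "Z \<in> vector_fields A" for X Y Z
    using lie_deriv_connection_sym[OF lc V] that by metis
  have skew: "?S X Y Z = - ?S X Z Y"
    if "X \<in> vector_fields A" "Y \<in> vector_fields A" "Z \<in> vector_fields A" for X Y Z
    using lie_deriv_connection_skew[OF g lc kf that] metric_sym[OF g that(2) T[OF that(1,3)]]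
    by simp
  \<comment> \<open>Alternating the two symmetries gives S(X,Y,Z) = S(Y,X,Z) = -S(Y,Z,X) = -S(Z,Y,X)
    = S(Z,X,Y) = S(X,Z,Y) = -S(X,Y,Z). Nondegeneracy of \<open>g\<close> then removes the third
    argument.\<close>
  have "?S X Y Z = 0" if Z: "Z \<in> vector_fields A" for Z
    using sym[OF X Y Z] skew[OF Y X Z] sym[OF Y Z X] skew[OF Z Y X] sym[OF Z X Y] skew[OF X Z Y]
    by simp
  with g T[OF X Y] f show ?thesis
    unfolding semi_riemannian_metric_def by blast
qed

end

lemma smooth_manifold_open_atlas: "smooth_manifold A \<Longrightarrow> open_atlas A"
  by (auto simp: smooth_manifold_def open_atlas_def)

text \<open>The whole tensor \<open>lie_deriv_connection \<xi> D\<close> vanishes, so every term of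
  the trace is zero.\<close>

theorem K_paracontact_infinitesimal_harmonic:
  assumes "K_paracontact_manifold A n \<phi> \<xi> \<eta> g" "levi_civita A g D"
  shows "infinitesimal_harmonic A g D \<xi>"
proof -
  have g: "semi_riemannian_metric A g" and kf: "killing_field A g \<xi>"
    using assms by (auto simp: K_paracontact_manifold_def paracontact_metric_manifold_def)
  interpret open_atlas A
    using assms(1) by (auto simp: K_paracontact_manifold_def paracontact_metric_manifold_def
        intro: smooth_manifold_open_atlas)
  show ?thesis
    using assms(2) kf lie_deriv_connection_killing[OF g assms(2) kf]
    by (auto simp: infinitesimal_harmonic_def killing_field_def metric_trace_zero_def
        pseudo_orthonormal_at_def)
qed

section \<open>Derivations of Euclidean space are directional derivatives\<close>

lemma smooth_on_continuous_compose:
  "smooth_on UNIV F \<Longrightarrow> continuous_on S h \<Longrightarrow> continuous_on S (\<lambda>x. F (h x))"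
  using continuous_on_compose2 smooth_on_continuous_on by blast

text \<open>Differentiation under the integral sign. These integrals are the coefficients in
  Hadamard's formula, and a derivation can be applied to them only if they are smooth.\<close>

lemma smooth_on_segment_integral:
  fixes F :: "'a::euclidean_space \<Rightarrow> real"
  assumes "smooth_on UNIV F"
  shows "smooth_on UNIV (\<lambda>x. integral {0..1} (\<lambda>t. F (p + t *\<^sub>R (x - p))))"
proof -
  \<comment> \<open>Each differentiation in \<open>x\<close> brings out a factor \<open>t\<close> by
    the chain rule; the weight \<open>t ^ m\<close> makes the claim stable under it.\<close>
  have "Ck_on k UNIV (\<lambda>x. integral (cbox 0 1) (\<lambda>t. t ^ m * F (p + t *\<^sub>R (x - p))))" for k m
    using assms
  proof (induction k arbitrary: m F)
    case 0
    have "continuous_on (UNIV \<times> cbox 0 1) (\<lambda>(x, t). t ^ m * F (p + t *\<^sub>R (x - p)))"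
      unfolding case_prod_beta
      by (intro continuous_intros smooth_on_continuous_compose[OF 0])
    then show ?case
      unfolding Ck_on.simps
      by (rule integral_continuous_on_param)
  next
    case (Suc k)
    let ?G = "\<lambda>x. integral (cbox 0 1) (\<lambda>t. t ^ m * F (p + t *\<^sub>R (x - p)))"
    \<comment> \<open>\<open>leibniz_rule\<close> takes the derivative of the integrand as a bounded
      linear map continuous in \<open>(x, t)\<close>. In finite dimension this continuity can be
      checked on basis vectors.\<close>
    define F' where "F' x t = Blinfun (\<lambda>v. t ^ Suc m * frechet_derivative F (at (p + t *\<^sub>R (x - p))) v)"
      for x :: 'a and t
    have bl: "bounded_linear (frechet_derivative F (at x))" for x
      using smooth_on_has_derivative[OF Suc.prems] has_derivative_bounded_linear by blast
    have F': "blinfun_apply (F' x t) =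
        (\<lambda>v. t ^ Suc m * frechet_derivative F (at (p + t *\<^sub>R (x - p))) v)" for x t
      unfolding F'_def by (intro bounded_linear_Blinfun_apply bounded_linear_const_mult bl)
    have cont: "continuous_on (UNIV \<times> cbox 0 1) (\<lambda>(x, t). F' x t)"
    proof (rule continuous_on_blinfun_componentwise)
      fix i :: 'a
      show "continuous_on (UNIV \<times> cbox 0 1) (\<lambda>x. blinfun_apply (case x of (x, t) \<Rightarrow> F' x t) i)"
        unfolding case_prod_beta F'
        by (intro continuous_intros
            smooth_on_continuous_compose[OF smooth_on_frechet_derivative[OF Suc.prems]])
    qed
    have integrable: "(\<lambda>t. F' x t) integrable_on cbox 0 1" for x
    proof (rule integrable_continuous)
      show "continuous_on (cbox 0 1) (\<lambda>t. F' x t)"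
        using continuous_on_compose2[OF cont, of "cbox 0 1" "\<lambda>t. (x, t)"]
        by (simp add: continuous_on_Pair image_subset_iff)
    qed
    have deriv_inside: "((\<lambda>x. t ^ m * F (p + t *\<^sub>R (x - p))) has_derivative blinfun_apply (F' x t)) (at x)" for x t
    proof -
      have inner: "((\<lambda>x. p + t *\<^sub>R (x - p)) has_derivative (\<lambda>v. t *\<^sub>R v)) (at x)"
        by (auto intro!: derivative_eq_intros)
      from has_derivative_compose[OF inner smooth_on_has_derivative[OF Suc.prems UNIV_I]]
      have "((\<lambda>x. t ^ m * F (p + t *\<^sub>R (x - p))) has_derivative
          (\<lambda>v. t ^ m * frechet_derivative F (at (p + t *\<^sub>R (x - p))) (t *\<^sub>R v))) (at x)"
        by (rule has_derivative_mult_right)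
      then show ?thesis
        by (simp add: F' linear_scale[OF bounded_linear.linear[OF bl]] mult_ac)
    qed
    have deriv: "(?G has_derivative blinfun_apply (integral (cbox 0 1) (F' x))) (at x)" for x
    proof (rule leibniz_rule[OF deriv_inside _ cont UNIV_I convex_UNIV])
      fix x
      have "continuous_on (cbox 0 1) (\<lambda>t. t ^ m * F (p + t *\<^sub>R (x - p)))"
        by (intro continuous_intros smooth_on_continuous_compose[OF Suc.prems])
      then show "(\<lambda>t. t ^ m * F (p + t *\<^sub>R (x - p))) integrable_on cbox 0 1"
        by (rule integrable_continuous)
    qed
    have "frechet_derivative ?G (at x) v =
        integral (cbox 0 1) (\<lambda>t. t ^ Suc m * frechet_derivative F (at (p + t *\<^sub>R (x - p))) v)" for x v
    proof -
      have "frechet_derivative ?G (at x) v = blinfun_apply (integral (cbox 0 1) (F' x)) v"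
        using frechet_derivative_at[OF deriv] by metis
      also have "\<dots> = integral (cbox 0 1) (\<lambda>t. blinfun_apply (F' x t) v)"
        using integral_linear[OF integrable blinfun.bounded_linear_left] by (simp add: o_def)
      finally show ?thesis by (simp add: F')
    qed
    moreover have "Ck_on k UNIV
        (\<lambda>x. integral (cbox 0 1) (\<lambda>t. t ^ Suc m * frechet_derivative F (at (p + t *\<^sub>R (x - p))) v))" for v
      by (intro Suc.IH smooth_on_frechet_derivative Suc.prems)
    moreover have "?G differentiable (at x)" for x
      using deriv differentiable_def by blast
    ultimately show ?case by simp
  qed
  from this[of _ 0] show ?thesis by (simp add: smooth_on_def)
qed

text \<open>The fundamental theorem of calculus along the segment from \<open>p\<close> to
  \<open>x\<close>, with the derivative in direction \<open>x - p\<close> expanded in the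
  basis.\<close>

lemma hadamard:
  fixes F :: "'a::euclidean_space \<Rightarrow> real"
  assumes F: "smooth_on UNIV F"
  shows "F x = F p + (\<Sum>b\<in>Basis. ((x - p) \<bullet> b) *
    integral {0..1} (\<lambda>t. frechet_derivative F (at (p + t *\<^sub>R (x - p))) b))"
proof -
  let ?F' = "\<lambda>t. frechet_derivative F (at (p + t *\<^sub>R (x - p)))"
  have lin: "linear (frechet_derivative F (at y))" for y
    using smooth_on_has_derivative[OF F] has_derivative_linear by blast
  have "((\<lambda>t. F (p + t *\<^sub>R (x - p))) has_vector_derivative ?F' t (x - p)) (at t within {0..1})" for t
  proof -
    have inner: "((\<lambda>t. p + t *\<^sub>R (x - p)) has_derivative (\<lambda>s. s *\<^sub>R (x - p))) (at t within {0..1})"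
      by (auto intro!: derivative_eq_intros)
    from has_derivative_compose[OF inner smooth_on_has_derivative[OF F UNIV_I]]
    show ?thesis
      by (simp add: has_vector_derivative_def linear_scale[OF lin])
  qed
  then have "((\<lambda>t. ?F' t (x - p)) has_integral F (p + 1 *\<^sub>R (x - p)) - F (p + 0 *\<^sub>R (x - p))) {0..1}"
    by (intro fundamental_theorem_of_calculus) auto
  then have "F x - F p = integral {0..1} (\<lambda>t. ?F' t (x - p))"
    by (simp add: integral_unique)
  also have "(\<lambda>t. ?F' t (x - p)) = (\<lambda>t. \<Sum>b\<in>Basis. ((x - p) \<bullet> b) * ?F' t b)"
  proof
    fix t
    have "?F' t (x - p) = ?F' t (\<Sum>b\<in>Basis. ((x - p) \<bullet> b) *\<^sub>R b)"
      by (simp only: euclidean_representation)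
    then show "?F' t (x - p) = (\<Sum>b\<in>Basis. ((x - p) \<bullet> b) * ?F' t b)"
      by (simp add: linear_sum[OF lin] linear_scale[OF lin])
  qed
  also have "integral {0..1} \<dots> = (\<Sum>b\<in>Basis. integral {0..1} (\<lambda>t. ((x - p) \<bullet> b) * ?F' t b))"
  proof (intro integral_sum integrable_continuous_real)
    show "continuous_on {0..1} (\<lambda>t. ((x - p) \<bullet> b) * ?F' t b)" for b
      by (intro continuous_intros smooth_on_continuous_compose[OF smooth_on_frechet_derivative[OF F]])
  qed simp
  finally show ?thesis by simp
qed

section \<open>Euclidean space with the identity chart\<close>

definition euclidean_atlas :: "('e, 'e::euclidean_space) atlas" where
  "euclidean_atlas = {(UNIV, id)}"

lemma smooth_manifold_euclidean_atlas: "smooth_manifold euclidean_atlas"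
  by (auto simp: smooth_manifold_def euclidean_atlas_def connected_UNIV o_def
      homeomorphism_def intro!: smooth_on_bounded_linear bounded_linear_ident[folded id_def])

lemma smooth_functions_euclidean_atlas: "smooth_functions euclidean_atlas = {f. smooth_on UNIV f}"
  by (simp add: smooth_functions_def euclidean_atlas_def)

interpretation euclidean: open_atlas euclidean_atlas
  by (rule smooth_manifold_open_atlas) (rule smooth_manifold_euclidean_atlas)

lemma inner_smooth: "(\<lambda>x. x \<bullet> b) \<in> smooth_functions euclidean_atlas"
  by (simp add: smooth_functions_euclidean_atlas smooth_on_bounded_linear bounded_linear_inner_left)

text \<open>Apply the derivation to Hadamard's formula; at \<open>p\<close> only the terms in which it
  differentiates the factors \<open>(x - p) \<bullet> b\<close> survive.\<close>
lemma derivation_eq_directional: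
  fixes p :: "'e::euclidean_space"
  assumes X: "X \<in> vector_fields euclidean_atlas" and f: "f \<in> smooth_functions euclidean_atlas"
  shows "X f p = (\<Sum>b\<in>Basis. X (\<lambda>x. x \<bullet> b) p * frechet_derivative f (at p) b)"
proof -
  note [simp] = euclidean.smooth_functions_intros inner_smooth
  have F: "smooth_on UNIV f" using f by (simp add: smooth_functions_euclidean_atlas)
  define G where "G b x = integral {0..1} (\<lambda>t. frechet_derivative f (at (p + t *\<^sub>R (x - p))) b)"
    for b x
  have G [simp]: "G b \<in> smooth_functions euclidean_atlas" for b
    unfolding smooth_functions_euclidean_atlas G_def
    by (simp add: smooth_on_segment_integral[of "\<lambda>x. frechet_derivative f (at x) b"]
        smooth_on_frechet_derivative[OF F])
  have G_p: "G b p = frechet_derivative f (at p) b" for b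
    by (simp add: G_def)
  have term_smooth: "(\<lambda>x. (x \<bullet> b - p \<bullet> b) * G b x) \<in> smooth_functions euclidean_atlas" for b
    by simp
  have X_term: "X (\<lambda>x. (x \<bullet> b - p \<bullet> b) * G b x) =
      (\<lambda>x. X (\<lambda>x. x \<bullet> b) x * G b x + (x \<bullet> b - p \<bullet> b) * X (G b) x)" for b
  proof -
    have "X (\<lambda>x. x \<bullet> b - p \<bullet> b) = (\<lambda>x. X (\<lambda>x. x \<bullet> b) x)"
      by (subst euclidean.derivation_diff[OF X]) (simp_all add: euclidean.derivation_const[OF X])
    then show ?thesis by (subst euclidean.derivation_mult[OF X]) simp_all
  qed
  have "f = (\<lambda>x. f p + (\<Sum>b\<in>Basis. (x \<bullet> b - p \<bullet> b) * G b x))"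
    using hadamard[OF F, of _ p] unfolding G_def inner_diff_left by (rule ext)
  then have "X f p = X (\<lambda>x. f p + (\<Sum>b\<in>Basis. (x \<bullet> b - p \<bullet> b) * G b x)) p"
    by (rule arg_cong[where f = "\<lambda>h. X h p"])
  also have "\<dots> = (\<Sum>b\<in>Basis. X (\<lambda>x. (x \<bullet> b - p \<bullet> b) * G b x) p)"
    by (subst euclidean.derivation_add[OF X])
      (simp_all only: euclidean.derivation_sum[OF X finite_Basis term_smooth]
        euclidean.derivation_const[OF X] euclidean.smooth_functions_const add_0)
  also have "\<dots> = (\<Sum>b\<in>Basis. X (\<lambda>x. x \<bullet> b) p * frechet_derivative f (at p) b)"
    by (simp add: X_term G_p)
  finally show ?thesis .
qed

text \<open>The case distinction supplies the value zero that \<open>vector_fields\<close>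
  prescribes on non-smooth functions.\<close>

definition directional :: "'e \<Rightarrow> 'e::euclidean_space vfield" where
  "directional v f = (if f \<in> smooth_functions euclidean_atlas
     then \<lambda>p. frechet_derivative f (at p) v else (\<lambda>p. 0))"

lemma frechet_derivative_mult:
  fixes f h :: "'a::real_normed_vector \<Rightarrow> real"
  assumes "f differentiable (at p)" "h differentiable (at p)"
  shows "frechet_derivative (\<lambda>x. f x * h x) (at p) v =
    f p * frechet_derivative h (at p) v + frechet_derivative f (at p) v * h p"
proof -
  note D = assms[unfolded frechet_derivative_works]
  show ?thesis
    using fun_cong[OF frechet_derivative_at[OF has_derivative_mult[OF D]], of v] by simp
qed

lemma frechet_derivative_add:
  assumes "f differentiable (at p)" "h differentiable (at p)"
  shows "frechet_derivative (\<lambda>x. f x + h x) (at p) v =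
    frechet_derivative f (at p) v + frechet_derivative h (at p) v"
proof -
  note D = assms[unfolded frechet_derivative_works]
  show ?thesis
    using fun_cong[OF frechet_derivative_at[OF has_derivative_add[OF D]], of v] by simp
qed

lemma directional_vector_fields: "directional v \<in> vector_fields euclidean_atlas"
proof (rule euclidean.vector_fieldsI)
  fix f h :: "'a \<Rightarrow> real" and c :: real and p
  assume f: "f \<in> smooth_functions euclidean_atlas"
  have df: "f differentiable (at p)"
    using f by (simp add: smooth_functions_euclidean_atlas smooth_on_differentiable)
  show "directional v f \<in> smooth_functions euclidean_atlas"
    using f by (simp add: directional_def smooth_functions_euclidean_atlas smooth_on_frechet_derivative)
  show "directional v (\<lambda>p. c * f p) p = c * directional v f p"
    using f df frechet_derivative_mult[of "\<lambda>p. c" p f]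
    by (simp add: directional_def euclidean.smooth_functions_intros)
  assume h: "h \<in> smooth_functions euclidean_atlas"
  have dh: "h differentiable (at p)"
    using h by (simp add: smooth_functions_euclidean_atlas smooth_on_differentiable)
  show "directional v (\<lambda>p. f p + h p) p = directional v f p + directional v h p"
    using f h df dh frechet_derivative_add[of f p h]
    by (simp add: directional_def euclidean.smooth_functions_intros)
  show "directional v (\<lambda>p. f p * h p) p = directional v f p * h p + f p * directional v h p"
    using f h df dh
    by (simp add: directional_def euclidean.smooth_functions_intros frechet_derivative_mult)
qed (simp add: directional_def)

lemma directional_inner: "directional v (\<lambda>x. x \<bullet> b) = (\<lambda>p. v \<bullet> b)"
  using frechet_derivative_at[OF bounded_linear_imp_has_derivative[OF bounded_linear_inner_left[of b]]]
  by (auto simp: directional_def inner_smooth fun_eq_iff)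

section \<open>A left-invariant paracontact structure with nilpotent \<open>h\<close>\<close>

text \<open>The inner power is already antisymmetrised, with factor 1/2, so the two permutations
  with equal value at 0 contribute equally; this leaves 2 * 1/2 * 1/6 = 1/6. The differences stay
  because \<omega> is an arbitrary function of two fields.\<close>

lemma wedge_1_2:
  "wedge 1 2 (\<lambda>X. \<eta> (X 0)) (wedge_power_2 (\<lambda>X. \<omega> (X 0) (X 1)) 1) X p =
    (\<eta> (X 0) p * (\<omega> (X 1) (X 2) p - \<omega> (X 2) (X 1) p)
    + \<eta> (X 1) p * (\<omega> (X 2) (X 0) p - \<omega> (X 0) (X 2) p)
    + \<eta> (X 2) p * (\<omega> (X 0) (X 1) p - \<omega> (X 1) (X 0) p)) / 6"
proof -
  have s2: "{..<Suc (Suc 0)} = {0, 1 :: nat}" and s3: "{..<Suc (Suc (Suc 0))} = {0, 1, 2 :: nat}"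
    by auto
  have f: "finite {1, 2 :: nat}" "0 \<notin> {1, 2 :: nat}" "finite {2 :: nat}" "1 \<notin> {2 :: nat}"
    "finite {1 :: nat}" "0 \<notin> {1 :: nat}"
    by auto
  have two: "wedge_power_2 (\<lambda>X. \<omega> (X 0) (X 1)) 1 Y p = (\<omega> (Y 0) (Y 1) p - \<omega> (Y 1) (Y 0) p) / 2" for Y
    unfolding One_nat_def wedge_power_2.simps wedge_def
    apply (simp add: s2 numeral_2_eq_2)
    \<comment> \<open>Permutations are enumerated by inserting the elements one at a time, each
      permutation being a transposition composed with a permutation of the smaller set.\<close>
    unfolding One_nat_def[symmetric] sum_over_permutations_insert[OF f(5,6)] permutes_sing
    by (simp add: sign_swap_id permutation_swap_id sign_compose sign_id)
  show ?thesis
    unfolding wedge_def[of 1 2] two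
    apply (simp add: s3 numeral_2_eq_2)
    unfolding One_nat_def[symmetric] Suc_1
      sum_over_permutations_insert[OF f(1,2)] sum_over_permutations_insert[OF f(3,4)] permutes_sing
    by (simp add: sign_swap_id permutation_swap_id sign_compose sign_id transpose_def field_simps fact_numeral)
qed

text \<open>The hypotheses make \<open>G ** transpose M ** J\<close> a right inverse of the square
  matrix \<open>M\<close>, hence also a left inverse. Read geometrically, a pseudo-orthonormal basis
  with coefficient matrix \<open>M\<close> and signs \<open>J\<close> yields the inverse of the Gram
  matrix \<open>G\<close>.\<close>

lemma matrix_frame_dual:
  fixes M G J :: "real^'n^'n"
  assumes "M ** G ** transpose M = J" "J ** J = mat 1"
  shows "G ** (transpose M ** J ** M) = mat 1"
proof -
  have "M ** (G ** transpose M ** J) = mat 1"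
    using assms by (simp add: matrix_mul_assoc)
  then have "(G ** transpose M ** J) ** M = mat 1"
    using matrix_left_right_inverse by blast
  then show ?thesis by (simp add: matrix_mul_assoc)
qed

text \<open>The sum is the entry of the inverse Gram matrix of the frame \<open>(U, W, \<xi>)\<close> at \<open>(U, \<xi>)\<close>.\<close>
lemma pseudo_orthonormal_null_frame:
  fixes a b c :: "nat \<Rightarrow> real"
  defines "q \<equiv> \<lambda>i j. a i * b j + b i * a j + c i * c j"
  assumes unit: "\<And>i. i < 3 \<Longrightarrow> q i i = 1 \<or> q i i = -1"
    and orth: "\<And>i j. i < 3 \<Longrightarrow> j < 3 \<Longrightarrow> i \<noteq> j \<Longrightarrow> q i j = 0"
  shows "(\<Sum>i<3. q i i * (a i * c i)) = 0"
proof -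
  \<comment> \<open>The rows of \<open>M\<close> are the basis vectors in terms of (U, W, \<xi>),
    \<open>G\<close> is the Gram matrix of that frame, and \<open>J\<close> carries the
    signs.\<close>
  define M :: "real^3^3" where "M = vector [vector [a 0, b 0, c 0], vector [a 1, b 1, c 1],
      vector [a 2, b 2, c 2]]"
  define G :: "real^3^3" where "G = vector [vector [0, 1, 0], vector [1, 0, 0], vector [0, 0, 1]]"
  define J :: "real^3^3" where "J = vector [vector [q 0 0, 0, 0], vector [0, q 1 1, 0],
      vector [0, 0, q 2 2]]"
  note expand = vec_eq_iff forall_3 matrix_matrix_mult_def transpose_def sum_3 mat_def
  have "q 0 1 = 0" "q 0 2 = 0" "q 1 2 = 0" "q 1 0 = 0" "q 2 0 = 0" "q 2 1 = 0"
    using orth by auto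
  then have "M ** G ** transpose M = J"
    by (simp add: expand M_def G_def J_def q_def algebra_simps)
  moreover have "J ** J = mat 1"
    using unit[of 0] unit[of 1] unit[of 2] by (auto simp: expand J_def)
  \<comment> \<open>The third row of \<open>G\<close> is (0, 0, 1), so this entry is the entry (3,
    1) of \<open>transpose M ** J ** M\<close>, which is the sum in question.\<close>
  ultimately have "(G ** (transpose M ** J ** M)) $ 3 $ 1 = 0"
    by (simp add: matrix_frame_dual mat_def)
  then show ?thesis
    by (simp add: matrix_matrix_mult_def transpose_def sum_3 M_def G_def J_def numeral_3_eq_3
        numeral_2_eq_2
        algebra_simps)
qed

section \<open>Coefficients of vector fields in the frame (U, W, \<xi>)\<close>

abbreviation R3 :: "(real^3, real^3) atlas" where "R3 \<equiv> euclidean_atlas"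

lemma nth_smooth: "(\<lambda>p. p $ i) \<in> smooth_functions R3"
  by (simp add: smooth_functions_euclidean_atlas smooth_on_bounded_linear bounded_linear_vec_nth)

lemma sum_Basis_3:
  fixes h :: "real^3 \<Rightarrow> real"
  shows "(\<Sum>b\<in>Basis. h b) = h (axis 1 1) + h (axis 2 1) + h (axis 3 1)"
proof -
  have Basis: "(Basis :: (real^3) set) = range (\<lambda>i. axis i 1)" by (auto simp: Basis_vec_def)
  have inj: "inj (\<lambda>i::3. axis i (1::real))" by (auto simp: inj_on_def axis_eq_axis)
  show ?thesis unfolding Basis by (simp add: sum.reindex[OF inj] sum_3)
qed

text \<open>\<open>coeff_U\<close>, \<open>coeff_W\<close> and \<open>coeff_xi\<close> form the
  coframe dual to (U, W, \<xi>), namely dx1, dx2 - x3 dx1 and dx3 + 2 x2 dx1. The last one serves as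
  the contact form.\<close>

definition coeff_U :: "(real^3) vfield \<Rightarrow> real^3 \<Rightarrow> real" where
  "coeff_U X = X (\<lambda>p. p $ 1)"

definition coeff_W :: "(real^3) vfield \<Rightarrow> real^3 \<Rightarrow> real" where
  "coeff_W X = (\<lambda>p. X (\<lambda>p. p $ 2) p - p $ 3 * X (\<lambda>p. p $ 1) p)"

definition coeff_xi :: "(real^3) vfield \<Rightarrow> real^3 \<Rightarrow> real" where
  "coeff_xi X = (\<lambda>p. X (\<lambda>p. p $ 3) p + 2 * p $ 2 * X (\<lambda>p. p $ 1) p)"

text \<open>The field a U + b W + c \<xi>, sorted by coordinate fields.\<close>

definition frame_field ::
  "(real^3 \<Rightarrow> real) \<Rightarrow> (real^3 \<Rightarrow> real) \<Rightarrow> (real^3 \<Rightarrow> real) \<Rightarrow> (real^3) vfield" where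
  "frame_field a b c =
    vf_add (vf_scale a (directional (axis 1 1)))
      (vf_add (vf_scale (\<lambda>p. b p + p $ 3 * a p) (directional (axis 2 1)))
        (vf_scale (\<lambda>p. c p - 2 * p $ 2 * a p) (directional (axis 3 1))))"

lemma coeff_frame_field [simp]:
  "coeff_U (frame_field a b c) = a" "coeff_W (frame_field a b c) = b"
  "coeff_xi (frame_field a b c) = c"
proof -
  have "directional v (\<lambda>p::real^3. p $ i) = (\<lambda>p. v $ i)" for v i
    using directional_inner[of v "axis i 1"] by (simp add: inner_axis)
  then show "coeff_U (frame_field a b c) = a" "coeff_W (frame_field a b c) = b"
    "coeff_xi (frame_field a b c) = c"
    by (auto simp: coeff_U_def coeff_W_def coeff_xi_def frame_field_def vf_add_def vf_scale_def
        axis_def)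
qed

lemma frame_field_vector_fields:
  "a \<in> smooth_functions R3 \<Longrightarrow> b \<in> smooth_functions R3 \<Longrightarrow> c \<in> smooth_functions R3 \<Longrightarrow>
    frame_field a b c \<in> vector_fields R3"
  unfolding frame_field_def
  by (intro euclidean.vector_fields_intros euclidean.smooth_functions_intros nth_smooth
      directional_vector_fields)

text \<open>By Hadamard's formula a derivation is determined by its values on the coordinates, and
  these correspond to the frame coefficients by a triangular change of basis.\<close>

lemma vector_field_eq_frame_field:
  assumes X: "X \<in> vector_fields R3" and f: "f \<in> smooth_functions R3"
  shows "X f p = frame_field (coeff_U X) (coeff_W X) (coeff_xi X) f p"
  using derivation_eq_directional[OF X f, of p]
  by (simp add: sum_Basis_3 inner_axis frame_field_def vf_add_def vf_scale_def directional_def f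
      coeff_U_def coeff_W_def coeff_xi_def)

text \<open>Reduces each identity between fields in the example to three scalar identities; on
  non-smooth functions both sides are zero.\<close>

lemma vector_field_eqI:
  assumes X: "X \<in> vector_fields R3" and Y: "Y \<in> vector_fields R3"
    and "\<And>p. coeff_U X p = coeff_U Y p" "\<And>p. coeff_W X p = coeff_W Y p"
      "\<And>p. coeff_xi X p = coeff_xi Y p"
  shows "X = Y"
proof
  fix f
  have eq: "coeff_U X = coeff_U Y" "coeff_W X = coeff_W Y" "coeff_xi X = coeff_xi Y"
    using assms by auto
  show "X f = Y f"
  proof (cases "f \<in> smooth_functions R3")
    case True
    then show ?thesis
      using vector_field_eq_frame_field[OF X] vector_field_eq_frame_field[OF Y] eq by auto
  qed (simp add: euclidean.vector_fields_outside X Y)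
qed

lemma coeff_smooth:
  assumes X: "X \<in> vector_fields R3"
  shows "coeff_U X \<in> smooth_functions R3" "coeff_W X \<in> smooth_functions R3"
    "coeff_xi X \<in> smooth_functions R3"
  unfolding coeff_U_def coeff_W_def coeff_xi_def
  by (intro euclidean.smooth_functions_intros nth_smooth euclidean.vector_fields_smooth[OF X])+

lemma coeff_simps [simp]:
  "coeff_U (vf_add X Y) = (\<lambda>p. coeff_U X p + coeff_U Y p)"
  "coeff_W (vf_add X Y) = (\<lambda>p. coeff_W X p + coeff_W Y p)"
  "coeff_xi (vf_add X Y) = (\<lambda>p. coeff_xi X p + coeff_xi Y p)"
  "coeff_U (vf_diff X Y) = (\<lambda>p. coeff_U X p - coeff_U Y p)"
  "coeff_W (vf_diff X Y) = (\<lambda>p. coeff_W X p - coeff_W Y p)"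
  "coeff_xi (vf_diff X Y) = (\<lambda>p. coeff_xi X p - coeff_xi Y p)"
  "coeff_U (vf_scale u X) = (\<lambda>p. u p * coeff_U X p)"
  "coeff_W (vf_scale u X) = (\<lambda>p. u p * coeff_W X p)"
  "coeff_xi (vf_scale u X) = (\<lambda>p. u p * coeff_xi X p)"
  by (simp_all add: coeff_U_def coeff_W_def coeff_xi_def vf_add_def vf_diff_def vf_scale_def
      algebra_simps)

lemma vf_apply:
  "vf_add X Y f p = X f p + Y f p" "vf_scale u X f p = u p * X f p"
  by (simp_all add: vf_add_def vf_scale_def)

text \<open>These are the bracket relations \<open>[U, W] = 2\<xi>\<close>, \<open>[\<xi>, U] = W\<close>, \<open>[\<xi>, W] = 0\<close>.\<close>
lemma coeff_lie_bracket:
  assumes X: "X \<in> vector_fields R3" and Y: "Y \<in> vector_fields R3"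
  shows "coeff_U (lie_bracket X Y) p = X (coeff_U Y) p - Y (coeff_U X) p"
    "coeff_W (lie_bracket X Y) p = X (coeff_W Y) p - Y (coeff_W X) p
      + coeff_xi X p * coeff_U Y p - coeff_U X p * coeff_xi Y p"
    "coeff_xi (lie_bracket X Y) p = X (coeff_xi Y) p - Y (coeff_xi X) p
      + 2 * (coeff_U X p * coeff_W Y p - coeff_W X p * coeff_U Y p)"
proof -
  note [simp] = euclidean.derivation_simps[OF X] euclidean.derivation_simps[OF Y]
    euclidean.smooth_functions_intros nth_smooth
    euclidean.vector_fields_smooth[OF X] euclidean.vector_fields_smooth[OF Y]
  show "coeff_U (lie_bracket X Y) p = X (coeff_U Y) p - Y (coeff_U X) p"
    "coeff_W (lie_bracket X Y) p = X (coeff_W Y) p - Y (coeff_W X) p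
      + coeff_xi X p * coeff_U Y p - coeff_U X p * coeff_xi Y p"
    "coeff_xi (lie_bracket X Y) p = X (coeff_xi Y) p - Y (coeff_xi X) p
      + 2 * (coeff_U X p * coeff_W Y p - coeff_W X p * coeff_U Y p)"
    by (simp_all add: coeff_U_def coeff_W_def coeff_xi_def lie_bracket_def algebra_simps)
qed


section \<open>The structure tensors and the connection of the example\<close>

definition reeb :: "(real^3) vfield" where
  "reeb = frame_field (\<lambda>p. 0) (\<lambda>p. 0) (\<lambda>p. 1)"

definition phi :: "(real^3) vfield \<Rightarrow> (real^3) vfield" where
  "phi X = frame_field (coeff_U X) (\<lambda>p. - coeff_W X p) (\<lambda>p. 0)"

definition metric :: "(real^3) vfield \<Rightarrow> (real^3) vfield \<Rightarrow> real^3 \<Rightarrow> real" where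
  "metric X Y =
    (\<lambda>p. coeff_U X p * coeff_W Y p + coeff_W X p * coeff_U Y p + coeff_xi X p * coeff_xi Y p)"

text \<open>The coefficients come from Koszul's formula for the frame \<open>(U, W, \<xi>)\<close>.\<close>
definition connection :: "(real^3) vfield \<Rightarrow> (real^3) vfield \<Rightarrow> (real^3) vfield" where
  "connection X Y = frame_field
    (\<lambda>p. X (coeff_U Y) p - coeff_U X p * coeff_xi Y p - coeff_xi X p * coeff_U Y p)
    (\<lambda>p. X (coeff_W Y) p - coeff_U X p * coeff_xi Y p + coeff_W X p * coeff_xi Y p
      + coeff_xi X p * coeff_W Y p)
    (\<lambda>p. X (coeff_xi Y) p + coeff_U X p * coeff_U Y p + coeff_U X p * coeff_W Y p
      - coeff_W X p * coeff_U Y p)"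

lemmas coeff_connection =
  arg_cong[OF connection_def, of coeff_U, unfolded coeff_frame_field]
  arg_cong[OF connection_def, of coeff_W, unfolded coeff_frame_field]
  arg_cong[OF connection_def, of coeff_xi, unfolded coeff_frame_field]

lemma reeb_vector_field: "reeb \<in> vector_fields R3"
  by (simp add: reeb_def frame_field_vector_fields euclidean.smooth_functions_const)

lemma coeff_reeb [simp]: "coeff_U reeb = (\<lambda>p. 0)" "coeff_W reeb = (\<lambda>p. 0)" "coeff_xi reeb = (\<lambda>p. 1)"
  by (simp_all add: reeb_def)

lemma phi_vector_field: "X \<in> vector_fields R3 \<Longrightarrow> phi X \<in> vector_fields R3"
  by (simp add: phi_def frame_field_vector_fields euclidean.smooth_functions_intros coeff_smooth)

lemma connection_vector_field:
  assumes X: "X \<in> vector_fields R3" and Y: "Y \<in> vector_fields R3"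
  shows "connection X Y \<in> vector_fields R3"
  unfolding connection_def
  by (intro frame_field_vector_fields euclidean.smooth_functions_intros
      euclidean.vector_fields_smooth[OF X] coeff_smooth[OF X] coeff_smooth[OF Y])

text \<open>The derivative terms cancel against those of the bracket. What remains is minus half the
  algebraic \<xi>-part of the bracket, and the 2 in [U, W] = 2\<xi> absorbs the half.\<close>

lemma ext_deriv_coeff_xi:
  assumes X: "X \<in> vector_fields R3" and Y: "Y \<in> vector_fields R3"
  shows "ext_deriv coeff_xi X Y p = coeff_W X p * coeff_U Y p - coeff_U X p * coeff_W Y p"
  by (simp add: ext_deriv_def coeff_lie_bracket[OF X Y])

lemma contact_form_coeff_xi: "contact_form R3 1 coeff_xi"
proof -
  have "\<exists>X. (\<forall>i. X i \<in> vector_fields R3) \<and>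
      wedge 1 2 (\<lambda>X. coeff_xi (X 0)) (wedge_power_2 (\<lambda>X. ext_deriv coeff_xi (X 0) (X 1)) 1) X p \<noteq> 0"
    for p
  proof -
    \<comment> \<open>The witness is the frame in the order \<xi>, U, W, continued by zero fields.
      Only the first summand of \<open>wedge_1_2\<close> survives, with value (-1 - 1) / 6.\<close>
    define X where "X i = frame_field (\<lambda>p. if i = 1 then 1 else 0) (\<lambda>p. if i = 2 then 1 else 0)
      (\<lambda>p. if i = 0 then 1 else 0)" for i :: nat
    have X: "X i \<in> vector_fields R3" for i
      by (simp add: X_def frame_field_vector_fields euclidean.smooth_functions_const)
    have "wedge 1 2 (\<lambda>X. coeff_xi (X 0)) (wedge_power_2 (\<lambda>X. ext_deriv coeff_xi (X 0) (X 1)) 1) X p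
        = - 1 / 3"
      unfolding wedge_1_2 by (simp add: ext_deriv_coeff_xi[OF X X]) (simp add: X_def)
    then show ?thesis using X by (intro exI[of _ X]) simp
  qed
  then show ?thesis
    by (auto simp: contact_form_def one_forms_def coeff_smooth)
qed

lemma metric_semi_riemannian: "semi_riemannian_metric R3 metric"
  unfolding semi_riemannian_metric_def
proof (intro conjI ballI allI impI)
  fix X assume X: "X \<in> vector_fields R3"
  show "metric X \<in> one_forms R3"
    unfolding one_forms_def
    using X by (auto simp: metric_def coeff_smooth algebra_simps intro!: euclidean.smooth_functions_intros)
  show "metric X Y = metric Y X" for Y
    by (simp add: metric_def algebra_simps)
  fix p f assume null: "\<forall>Y\<in>vector_fields R3. metric X Y p = 0" and f: "f \<in> smooth_functions R3"
  \<comment> \<open>Testing against U, W and \<xi> reads off \<open>coeff_W\<close>,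
    \<open>coeff_U\<close> and \<open>coeff_xi\<close> of \<open>X\<close> respectively.\<close>
  have "metric X (frame_field (\<lambda>p. a) (\<lambda>p. b) (\<lambda>p. c)) p = 0" for a b c
    using null by (simp add: frame_field_vector_fields euclidean.smooth_functions_const)
  from this[of 1 0 0] this[of 0 1 0] this[of 0 0 1]
  have "coeff_U X p = 0" "coeff_W X p = 0" "coeff_xi X p = 0"
    by (simp_all add: metric_def)
  then show "X f p = 0"
    using vector_field_eq_frame_field[OF X f, of p]
    by (simp add: frame_field_def vf_apply)
qed

lemma paracontact_example: "paracontact_metric_manifold R3 1 phi reeb coeff_xi metric"
  unfolding paracontact_metric_manifold_def
proof (intro conjI ballI)
  show "smooth_manifold R3" by (rule smooth_manifold_euclidean_atlas)
  show "contact_form R3 1 coeff_xi" by (rule contact_form_coeff_xi)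
  show "semi_riemannian_metric R3 metric" by (rule metric_semi_riemannian)
  show "reeb_field R3 coeff_xi reeb"
    by (auto simp: reeb_field_def reeb_vector_field ext_deriv_coeff_xi fun_eq_iff)
  show "phi \<in> endomorphism_fields R3"
    unfolding endomorphism_fields_def
    \<comment> \<open>Membership goals are closed while \<open>phi\<close> is folded; unfolding it
      afterwards leaves scalar identities.\<close>
    by (auto simp: phi_vector_field euclidean.vector_fields_intros
        intro!: vector_field_eqI) (auto simp: phi_def algebra_simps)
  fix X assume X: "X \<in> vector_fields R3"
  show "coeff_xi X = metric reeb X" by (simp add: metric_def)
  show "phi (phi X) = vf_diff X (vf_scale (coeff_xi X) reeb)"
    by (rule vector_field_eqI)
      (simp_all add: X phi_vector_field euclidean.vector_fields_intros coeff_smooth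
        reeb_vector_field, simp_all add: phi_def)
  fix Y assume Y: "Y \<in> vector_fields R3"
  show "ext_deriv coeff_xi X Y = metric X (phi Y)"
    by (simp add: fun_eq_iff ext_deriv_coeff_xi[OF X Y]) (simp add: metric_def phi_def)
qed

text \<open>On (U, U) the Lie derivative of the metric is -2 g([\<xi>, U], U) = -2 g(W, U) = -2, as
  g(U, U) is constant.\<close>

lemma not_killing_reeb: "\<not> killing_field R3 metric reeb"
proof
  assume kf: "killing_field R3 metric reeb"
  let ?U = "frame_field (\<lambda>p. 1) (\<lambda>p. 0) (\<lambda>p. 0)"
  have U: "?U \<in> vector_fields R3"
    by (simp add: frame_field_vector_fields euclidean.smooth_functions_const)
  have "lie_deriv_metric reeb metric ?U ?U p = -2" for p
    by (simp add: lie_deriv_metric_def metric_def coeff_lie_bracket[OF reeb_vector_field U]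
        euclidean.derivation_const[OF U] euclidean.derivation_const[OF reeb_vector_field])
  with kf U show False by (auto simp: killing_field_def)
qed

text \<open>\<open>connection\<close> differentiates the coefficients and adds a bilinear algebraic
  term. The antisymmetric part of that term matches the algebraic part of the bracket, giving zero
  torsion; for fixed \<open>X\<close> the term is skew with respect to \<open>metric\<close>, giving
  compatibility.\<close>

lemma levi_civita_connection: "levi_civita R3 metric connection"
  unfolding levi_civita_def
proof (intro conjI ballI)
  show "affine_connection R3 connection"
    unfolding affine_connection_def
  proof (intro conjI ballI)
    fix X Y assume X: "X \<in> vector_fields R3" and Y: "Y \<in> vector_fields R3"
    note cl = X Y connection_vector_field euclidean.vector_fields_intros coeff_smooth
      euclidean.vector_fields_smooth
    show "connection X Y \<in> vector_fields R3" by (simp add: cl)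
    {
      fix Z assume Z: "Z \<in> vector_fields R3"
      show "connection (vf_add X Y) Z = vf_add (connection X Z) (connection Y Z)"
        by (rule vector_field_eqI)
          (simp_all add: cl Z, simp_all add: coeff_connection vf_apply algebra_simps)
      show "connection X (vf_add Y Z) = vf_add (connection X Y) (connection X Z)"
        by (rule vector_field_eqI)
          (simp_all add: cl Z, simp_all add: coeff_connection euclidean.derivation_add[OF X] cl Z
            algebra_simps)
    }
    fix u assume u: "u \<in> smooth_functions R3"
    show "connection (vf_scale u X) Y = vf_scale u (connection X Y)"
      by (rule vector_field_eqI)
        (simp_all add: cl u, simp_all add: coeff_connection vf_apply algebra_simps)
    show "connection X (vf_scale u Y) =
        vf_add (vf_scale (X u) Y) (vf_scale u (connection X Y))"
      by (rule vector_field_eqI)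
        (simp_all add: cl u, simp_all add: coeff_connection euclidean.derivation_mult[OF X] cl u
          algebra_simps)
  qed
  fix X Y assume X: "X \<in> vector_fields R3" and Y: "Y \<in> vector_fields R3"
  note cl = X Y connection_vector_field euclidean.vector_fields_intros coeff_smooth
    euclidean.vector_fields_smooth
  show "vf_diff (connection X Y) (connection Y X) = lie_bracket X Y"
    by (rule vector_field_eqI)
      (simp_all add: cl coeff_lie_bracket, simp_all add: coeff_connection algebra_simps)
  fix Z assume Z: "Z \<in> vector_fields R3"
  show "X (metric Y Z) = (\<lambda>p. metric (connection X Y) Z p + metric Y (connection X Z) p)"
    unfolding metric_def
    by (simp add: euclidean.derivation_simps[OF X] euclidean.smooth_functions_intros cl Z
        coeff_connection algebra_simps)
qed

text \<open>All derivatives of the coefficients cancel, because the expression is a tensor; the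
  constants left over come from the structure constants and the connection coefficients.\<close>

lemma lie_deriv_connection_reeb:
  assumes X: "X \<in> vector_fields R3" and Y: "Y \<in> vector_fields R3"
  shows "coeff_U (lie_deriv_connection reeb connection X Y) p = 0"
    "coeff_W (lie_deriv_connection reeb connection X Y) p =
      - 2 * (coeff_U X p * coeff_xi Y p + coeff_xi X p * coeff_U Y p)"
    "coeff_xi (lie_deriv_connection reeb connection X Y) p = 0"
proof -
  let ?BX = "lie_bracket reeb X" and ?BY = "lie_bracket reeb Y"
  have BX: "?BX \<in> vector_fields R3" and BY: "?BY \<in> vector_fields R3"
    using X Y by (simp_all add: reeb_vector_field euclidean.lie_bracket_vector_fields)
  have D: "connection X Y \<in> vector_fields R3"
    using X Y by (rule connection_vector_field)
  note R = reeb_vector_field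
  \<comment> \<open>Bracketing with \<xi> differentiates each coefficient; the extra
    \<open>coeff_U Z\<close> comes from [\<xi>, U] = W.\<close>
  have coeff_bracket: "coeff_U (lie_bracket reeb Z) = (\<lambda>p. reeb (coeff_U Z) p)"
    "coeff_W (lie_bracket reeb Z) = (\<lambda>p. reeb (coeff_W Z) p + coeff_U Z p)"
    "coeff_xi (lie_bracket reeb Z) = (\<lambda>p. reeb (coeff_xi Z) p)"
    if Z: "Z \<in> vector_fields R3" for Z
    by (simp_all add: fun_eq_iff coeff_lie_bracket[OF R Z] euclidean.derivation_const[OF Z])
  have bracket_apply: "?BX h q = reeb (X h) q - X (reeb h) q" for h q
    by (simp add: lie_bracket_def)
  note facts = X Y R coeff_smooth euclidean.vector_fields_smooth euclidean.smooth_functions_intros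
  note rules = lie_deriv_connection_def coeff_bracket[OF D] coeff_bracket[OF X] coeff_bracket[OF Y]
    coeff_connection bracket_apply euclidean.derivation_simps[OF R]
    euclidean.derivation_simps[OF X]
  show "coeff_U (lie_deriv_connection reeb connection X Y) p = 0"
    "coeff_W (lie_deriv_connection reeb connection X Y) p =
      - 2 * (coeff_U X p * coeff_xi Y p + coeff_xi X p * coeff_U Y p)"
    "coeff_xi (lie_deriv_connection reeb connection X Y) p = 0"
    by (simp_all add: rules facts algebra_simps)
qed

lemma harmonic_reeb: "infinitesimal_harmonic R3 metric connection reeb"
  unfolding infinitesimal_harmonic_def metric_trace_zero_def
proof (intro conjI allI impI ballI)
  show "levi_civita R3 metric connection" by (rule levi_civita_connection)
  show "reeb \<in> vector_fields R3" by (rule reeb_vector_field)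
  fix p E f
  assume E: "pseudo_orthonormal_at R3 metric p E" and f: "f \<in> smooth_functions R3"
  let ?T = "lie_deriv_connection reeb connection"
  let ?W = "directional (axis 2 1) f p"
  have Ei: "E i \<in> vector_fields R3" if "i < 3" for i
    using E that by (simp add: pseudo_orthonormal_at_def)
  \<comment> \<open>On the diagonal the tensor is -4 times \<open>coeff_U\<close> times
    \<open>coeff_xi\<close> in direction W, so the trace is a multiple of the sum in
    \<open>pseudo_orthonormal_null_frame\<close>.\<close>
  have "(\<Sum>i<DIM(real^3). metric (E i) (E i) p * ?T (E i) (E i) f p) =
      (\<Sum>i<3. -4 * ?W * (metric (E i) (E i) p * (coeff_U (E i) p * coeff_xi (E i) p)))"
  proof (rule sum.cong)
    fix i :: nat assume "i \<in> {..<3}"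
    then have X: "E i \<in> vector_fields R3" using Ei by simp
    have "?T (E i) (E i) \<in> vector_fields R3"
      using levi_civita_connection reeb_vector_field X
      by (simp add: levi_civita_def euclidean.lie_deriv_connection_vector_fields)
    from vector_field_eq_frame_field[OF this f, of p]
    have "?T (E i) (E i) f p = -4 * ?W * (coeff_U (E i) p * coeff_xi (E i) p)"
      by (simp add: frame_field_def vf_apply lie_deriv_connection_reeb[OF X X])
    then show "metric (E i) (E i) p * ?T (E i) (E i) f p =
        -4 * ?W * (metric (E i) (E i) p * (coeff_U (E i) p * coeff_xi (E i) p))"
      by simp
  qed simp
  also have "\<dots> = -4 * ?W *
      (\<Sum>i<3. metric (E i) (E i) p * (coeff_U (E i) p * coeff_xi (E i) p))"
    by (rule sum_distrib_left[symmetric])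
  also have "(\<Sum>i<3. metric (E i) (E i) p * (coeff_U (E i) p * coeff_xi (E i) p)) = 0"
    using pseudo_orthonormal_null_frame[of "\<lambda>i. coeff_U (E i) p" "\<lambda>i. coeff_W (E i) p"
        "\<lambda>i. coeff_xi (E i) p"] E
    by (simp add: pseudo_orthonormal_at_def metric_def)
  finally show "(\<Sum>i<DIM(real^3). metric (E i) (E i) p * ?T (E i) (E i) f p) = 0" by simp
qed

theorem mainTheorem11:
  "(\<forall>(A :: ('a::{t2_space,second_countable_topology}, 'e::euclidean_space) atlas) n \<phi> \<xi> \<eta> g D.
      K_paracontact_manifold A n \<phi> \<xi> \<eta> g \<and> levi_civita A g D \<longrightarrow>
        infinitesimal_harmonic A g D \<xi>) \<and>
   (\<exists>(A :: (real ^ 3, real ^ 3) atlas) n \<phi> \<xi> \<eta> g D.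
      paracontact_metric_manifold A n \<phi> \<xi> \<eta> g \<and> \<not> K_paracontact_manifold A n \<phi> \<xi> \<eta> g \<and>
      infinitesimal_harmonic A g D \<xi>)"
  using K_paracontact_infinitesimal_harmonic paracontact_example not_killing_reeb harmonic_reeb
  unfolding K_paracontact_manifold_def by blast

end
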